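(* Let $a,b,c,d,e,f,u,v,w,x,y,z$ be twelve distinct spin orbitals, and let $\eta_1,\eta_2$ be two further distinct (ancilla) spin orbitals. Let $\theta\in\mathbb{R}$. Let $$\ket{\Psi}=\xi_1\ket{abcdef}+\xi_2\ket{abc\phi_1\phi_2\phi_3}+\xi_3\ket{def\phi_4\phi_5\phi_6}+\xi_4\ket{uvwxyz},$$ where $\xi_1,\dots,\xi_4$ are arbitrary coefficients and $\phi_1,\dots,\phi_6$ are orbitals not in $\{a,b,c,d,e,f,u,v,w,x,y,z,\eta_1,\eta_2\}$, with $\phi_1,\phi_2,\phi_3$ distinct and $\phi_4,\phi_5,\phi_6$ distinct (so the ancilla orbitals are empty in $\ket{\Psi}$). Then four triples and one quadruply controlled double reproduce the sextuple unitary coupled-cluster factor on $\ket{\Psi}$: $$U^{abc}_{uv\eta_1}(\tfrac{\pi}{2})\,U^{def}_{xy\eta_2}(\tfrac{\pi}{2})\,C_{uvxy}U^{wz}_{\eta_1\eta_2}(\theta)\,U^{xy\eta_2}_{def}(\tfrac{\pi}{2})\,U^{uv\eta_1}_{abc}(\tfrac{\pi}{2})\ket{\Psi}=e^{\theta\left(\hat A_{abcdef}^{uvwxyz}-(\hat A_{abcdef}^{uvwxyz})^\dagger\right)}\ket{\Psi},$$ and both sides equal $$\xi_1(\cos\theta\ket{abcdef}+\sin\theta\ket{uvwxyz})+\xi_2\ket{abc\phi_1\phi_2\phi_3}+\xi_3\ket{def\phi_4\phi_5\phi_6}+\xi_4(\cos\theta\ket{uvwxyz}-\sin\theta\ket{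abcdef}).$$
   Context: Work in the fermionic Fock space over a finite set of spin orbitals with creation and annihilation operators $\hat a_p^\dagger,\hat a_p$ satisfying $\{\hat a_p,\hat a_q\}=0$, $\{\hat a_p^\dagger,\hat a_q^\dagger\}=0$, $\{\hat a_p,\hat a_q^\dagger\}=\delta_{pq}$, vacuum $\ket{\mathrm{vac}}$ and number operators $\hat n_p=\hat a_p^\dagger\hat a_p$. A ket listing orbitals denotes the determinant $\ket{p_1p_2\cdots p_m}=\hat a_{p_1}^\dagger\hat a_{p_2}^\dagger\cdots\hat a_{p_m}^\dagger\ket{\mathrm{vac}}$; all orbitals not listed are empty. For disjoint lists of distinct orbitals $i_1,\dots,i_n$ and $p_1,\dots,p_n$, the rank-$n$ excitation operator is $\hat A_{i_1\cdots i_n}^{p_1\cdots p_n}=\hat a_{p_1}^\dagger\hat a_{p_2}^\dagger\cdots\hat a_{p_n}^\dagger\,\hat a_{i_n}\cdots\hat a_{i_2}\hat a_{i_1}$. The corresponding unitary coupled-cluster (UCC) factor with angle $\theta$ is $U_{i_1\cdots i_n}^{p_1\cdots p_n}(\theta)=\exp\!\big(\theta[\hat A_{i_1\cdots i_n}^{p_1\cdots p_n}-(\hat A_{i_1\cdots i_n}^{p_1\cdots p_n})^\dagger]\big)$. The controlled factor $C_{q_1\cdots q_k}U_{i_1\cdots i_n}^{p_1\cdots p_n}(\theta)$, with control orbitals $q_1,\dots,q_k$ distinct from all $i$'s and $p$'s, acts as $U_{i_1\cdots i_n}^{p_1\cdots p_n}(\theta)$ on determinants in which all of $q_1,\dots,q_k$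 are occupied, and as the identity on all other determinants; equivalently it is $\exp\!\big(\theta\,\hat n_{q_1}\cdots\hat n_{q_k}[\hat A_{i_1\cdots i_n}^{p_1\cdots p_n}-(\hat A_{i_1\cdots i_n}^{p_1\cdots p_n})^\dagger]\big)$. *)

theory Defs
  imports "HOL-Analysis.Analysis"
begin

text \<open>
  The spin orbitals are the elements of a finite type \<open>'o\<close>.  The fermionic Fock space is realised
  concretely in the occupation number representation: it is \<open>\<complex>\<close>-valued functions on the
  subsets of \<open>'o\<close>, where \<open>axis S 1\<close> is the normalised state in which exactly the orbitals in \<open>S\<close>
  are occupied.  Since the orthonormal basis is indexed by a finite type, operators are matrices.
\<close>

type_synonym 'o fock = "(complex, 'o set) vec"
type_synonym 'o fop = "((complex, 'o set) vec, 'o set) vec"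

definition adj :: "'o::finite fop \<Rightarrow> 'o fop" where
  "adj A = (\<chi> i j. cnj (A $ j $ i))"

text \<open>
  The fermionic sign refers to an auxiliary linear order of the orbitals.  Its choice is
  immaterial (different orders give unitarily equivalent operators and the same vacuum); we take
  the one induced by \<open>to_nat\<close>, which exists because finite types are countable.
\<close>

definition fsign :: "'o::finite \<Rightarrow> 'o set \<Rightarrow> complex" where
  "fsign p S = (- 1) ^ card {q \<in> S. to_nat q < to_nat p}"

definition ann :: "'o::finite \<Rightarrow> 'o fop" where
  "ann p = (\<chi> T S. if p \<in> S \<and> T = S - {p} then fsign p S else 0)"

definition cre :: "'o::finite \<Rightarrow> 'o fop" where
  "cre p = adj (ann p)"

definition vac :: "'o::finite fock" where
  "vac = axis {} 1"

definition num :: "'o::finite \<Rightarrow> 'o fop" where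
  "num p = cre p ** ann p"

definition op_prod :: "'o::finite fop list \<Rightarrow> 'o fop" where
  "op_prod As = foldr (**) As (mat 1)"

fun op_pow :: "'o::finite fop \<Rightarrow> nat \<Rightarrow> 'o fop" where
  "op_pow A 0 = mat 1"
| "op_pow A (Suc k) = A ** op_pow A k"

text \<open>
  The library's \<open>exp\<close> needs a normed algebra type class, which \<open>vec\<close> with its componentwise
  multiplication does not provide, hence the exponential series with the matrix product.
\<close>

definition op_exp :: "'o::finite fop \<Rightarrow> 'o fop" where
  "op_exp A = (\<Sum>k. (1 / fact k) *\<^sub>R op_pow A k)"

text \<open>\<open>slater [p\<^sub>1, \<dots>, p\<^sub>m]\<close> is the determinant \<open>|p\<^sub>1 \<dots> p\<^sub>m\<rangle>\<close>.\<close>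

definition slater :: "'o::finite list \<Rightarrow> 'o fock" where
  "slater ps = op_prod (map cre ps) *v vac"

text \<open>
  In the next three definitions the list \<open>ps\<close> of upper indices (into which \<open>exc\<close> excites) precedes
  the list \<open>is\<close> of lower indices; in \<open>cucc\<close> the list \<open>qs\<close> of control orbitals comes first.
\<close>

definition exc :: "'o::finite list \<Rightarrow> 'o list \<Rightarrow> 'o fop" where
  "exc ps is = op_prod (map cre ps) ** op_prod (map ann (rev is))"

definition ucc :: "'o::finite list \<Rightarrow> 'o list \<Rightarrow> real \<Rightarrow> 'o fop" where
  "ucc ps is \<theta> = op_exp (\<theta> *\<^sub>R (exc ps is - adj (exc ps is)))"

definition cucc :: "'o::finite list \<Rightarrow> 'o list \<Rightarrow> 'o list \<Rightarrow> real \<Rightarrow> 'o fop" where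
  "cucc qs ps is \<theta> = op_exp (\<theta> *\<^sub>R (op_prod (map num qs) ** (exc ps is - adj (exc ps is))))"


subsection \<open>Canonical anticommutation relations\<close>

lemma op_axis_nth: "(A *v axis j 1) $ i = A $ i $ j" for A :: "'o::finite fop"
  by (simp add: matrix_vector_mult_def axis_def if_distrib[of "\<lambda>t. _ * t"] cong: if_cong)

lemma op_eqI:
  fixes A B :: "'o::finite fop"
  assumes "\<And>S. A *v axis S 1 = B *v axis S 1"
  shows "A = B"
proof -
  have "A $ i $ j = B $ i $ j" for i j
    using arg_cong[OF assms[of j], of "\<lambda>v. v $ i"]
    by (simp add: op_axis_nth)
  then show ?thesis by (simp add: vec_eq_iff)
qed

lemma ann_axis:
  "ann p *v axis S 1 = (if p \<in> S then fsign p S *s axis (S - {p}) 1 else 0)"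
  unfolding vec_eq_iff op_axis_nth by (simp add: ann_def axis_def)

lemma fsign_diff [simp]: "fsign p (S - {p}) = fsign p S"
proof -
  have "{q \<in> S - {p}. to_nat q < to_nat p} = {q \<in> S. to_nat q < to_nat p}" by auto
  then show ?thesis by (simp add: fsign_def)
qed

lemma fsign_insert [simp]: "fsign p (insert p S) = fsign p S"
proof -
  have "{q \<in> insert p S. to_nat q < to_nat p} = {q \<in> S. to_nat q < to_nat p}" by auto
  then show ?thesis by (simp add: fsign_def)
qed

lemma cre_axis:
  "cre p *v axis S 1 = (if p \<in> S then 0 else fsign p S *s axis (insert p S) 1)"
proof -
  have "cnj (fsign q T) = fsign q T" for q :: 'a and T by (simp add: fsign_def)
  moreover have "(p \<in> T \<and> S = T - {p}) = (p \<notin> S \<and> T = insert p S)" for T by auto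
  ultimately show ?thesis
    unfolding vec_eq_iff op_axis_nth by (auto simp: cre_def adj_def ann_def axis_def)
qed

lemma fsign_square [simp]: "fsign p S * fsign p S = 1"
  by (simp add: fsign_def flip: power_add mult_2)

lemma fsign_insert':
  assumes "q \<notin> S"
  shows "fsign p (insert q S) = (if to_nat q < to_nat p then - fsign p S else fsign p S)"
proof -
  have "{r \<in> insert q S. to_nat r < to_nat p} =
    (if to_nat q < to_nat p then insert q {r \<in> S. to_nat r < to_nat p}
     else {r \<in> S. to_nat r < to_nat p})" by auto
  moreover have "finite {r \<in> S. to_nat r < to_nat p}" by simp
  ultimately show ?thesis using assms by (simp add: fsign_def)
qed

lemma fsign_diff':
  assumes "q \<in> S"
  shows "fsign p (S - {q}) = (if to_nat q < to_nat p then - fsign p S else fsign p S)"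
  using fsign_insert'[of q "S - {q}" p] assms by (auto simp: insert_absorb split: if_splits)

lemma mult_smult_vec: "A *v (c *s v) = c *s (A *v v)" for A :: "'o::finite fop"
  by (simp add: vector_scalar_commute)

lemmas op_axis_simps = matrix_vector_mult_add_rdistrib matrix_vector_mul_assoc[symmetric]
  ann_axis cre_axis mult_smult_vec matrix_vector_mul_lid

lemma adj_mult: "adj (A ** B) = adj B ** adj A"
  by (simp add: adj_def matrix_matrix_mult_def vec_eq_iff mult.commute)

lemma adj_add: "adj (A + B) = adj A + adj B"
  by (simp add: adj_def vec_eq_iff)

lemma adj_adj [simp]: "adj (adj A) = A"
  by (simp add: adj_def vec_eq_iff)

lemma adj_zero [simp]: "adj 0 = 0"
  by (simp add: adj_def vec_eq_iff)

lemma adj_one [simp]: "adj (mat 1) = mat 1"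
  by (auto simp add: adj_def vec_eq_iff mat_def)

lemma to_nat_less_antisym:
  "p \<noteq> q \<Longrightarrow> (to_nat p < to_nat q) = (\<not> to_nat q < to_nat (p :: 'o::finite))"
  by (metis from_nat_to_nat linorder_neqE_nat not_less_iff_gr_or_eq)

lemma ann_ann: "ann p ** ann q + ann q ** ann p = 0"
proof (cases "p = q")
  case True
  have "ann q ** ann q = 0"
    by (rule op_eqI) (simp add: op_axis_simps)
  with True show ?thesis by simp
next
  case False
  show ?thesis
  proof (rule op_eqI)
    fix S
    have "S - {q} - {p} = S - {p} - {q}" by auto
    with False show "(ann p ** ann q + ann q ** ann p) *v axis S 1 = 0 *v axis S 1"
      using to_nat_less_antisym[of p q]
      by (auto simp: op_axis_simps fsign_diff' vector_smult_assoc vec_eq_iff)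
  qed
qed

lemma cre_cre: "cre p ** cre q + cre q ** cre p = 0"
  using arg_cong[OF ann_ann[of q p], of adj] by (simp add: adj_add adj_mult cre_def)

lemma ann_cre: "ann p ** cre q + cre q ** ann p = (if p = q then mat 1 else 0)"
proof (rule op_eqI)
  fix S
  show "(ann p ** cre q + cre q ** ann p) *v axis S 1 = (if p = q then mat 1 else 0) *v axis S 1"
  proof (cases "p = q")
    case True
    then show ?thesis
      by (auto simp: op_axis_simps vector_smult_assoc insert_absorb)
  next
    case False
    then have "insert q S - {p} = insert q (S - {p})" by auto
    with False show ?thesis
      using to_nat_less_antisym[of p q]
      by (auto simp: op_axis_simps fsign_diff' fsign_insert' vector_smult_assoc mult.commute
          vec_eq_iff)
  qed
qed

lemma ann_vac: "ann p *v vac = 0"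
  by (simp add: vac_def ann_axis)

lemma num_axis: "num p *v axis S 1 = (if p \<in> S then axis S 1 else 0)"
  by (simp add: num_def op_axis_simps vector_smult_assoc insert_absorb)


subsection \<open>Convergence of the exponential series\<close>

lemma bounded_bilinear_op_mult:
  "bounded_bilinear ((**) :: 'o::finite fop \<Rightarrow> 'o fop \<Rightarrow> 'o fop)"
proof -
  have "bilinear ((**) :: 'o fop \<Rightarrow> 'o fop \<Rightarrow> 'o fop)"
    unfolding bilinear_def
    by (auto intro!: linearI simp: vec_eq_iff matrix_matrix_mult_def sum.distrib scaleR_sum_right
        distrib_left distrib_right)
  then show ?thesis by (simp add: bilinear_conv_bounded_bilinear)
qed

lemma summable_op_exp: "summable (\<lambda>k. (1 / fact k) *\<^sub>R op_pow A k)"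
  for A :: "'o::finite fop"
proof -
  obtain K where K: "K > 0" "\<And>B (C :: 'o fop). norm (B ** C) \<le> norm (B :: 'o fop) * norm C * K"
    using bounded_bilinear.pos_bounded[OF bounded_bilinear_op_mult[where 'o = 'o]] by blast
  have bound: "norm (op_pow A k) \<le> norm (mat 1 :: 'o fop) * (norm A * K) ^ k" for k
  proof (induction k)
    case (Suc k)
    have "norm (op_pow A (Suc k)) \<le> (norm A * K) * norm (op_pow A k)"
      using K(2)[of A "op_pow A k"] by (simp add: mult_ac)
    also have "\<dots> \<le> (norm A * K) * (norm (mat 1 :: 'o fop) * (norm A * K) ^ k)"
      using Suc K(1) by (intro mult_left_mono) auto
    finally show ?case by (simp add: mult_ac)
  qed simp
  have "summable (\<lambda>k. norm (mat 1 :: 'o fop) * (inverse (fact k) * (norm A * K) ^ k))"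
    by (intro summable_mult summable_exp)
  then show ?thesis
  proof (rule summable_comparison_test'[where N = 0])
    fix k :: nat
    show "norm ((1 / fact k) *\<^sub>R op_pow A k)
        \<le> norm (mat 1 :: 'o fop) * (inverse (fact k) * (norm A * K) ^ k)"
      using mult_left_mono[OF bound[of k], of "inverse (fact k)"]
      by (simp add: divide_inverse mult_ac)
  qed
qed

lemma op_exp_sums: "(\<lambda>k. (1 / fact k) *\<^sub>R (op_pow A k *v \<psi>)) sums (op_exp A *v \<psi>)"
  for A :: "'o::finite fop"
proof -
  have lin: "bounded_linear (\<lambda>B :: 'o fop. B *v \<psi>)"
    unfolding linear_conv_bounded_linear[symmetric]
    by (auto intro!: linearI simp: vec_eq_iff matrix_vector_mult_def sum.distrib scaleR_sum_right
        distrib_right)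
  have "(\<lambda>k. ((1 / fact k) *\<^sub>R op_pow A k) *v \<psi>) sums (op_exp A *v \<psi>)"
    unfolding op_exp_def
    by (intro bounded_linear.sums[OF lin] summable_sums summable_op_exp)
  then show ?thesis
    by (simp add: bounded_linear.linear[OF lin, THEN linear_scale])
qed


subsection \<open>Action of the controlled factor on determinants\<close>

lemma op_prod_simps [simp]:
  "op_prod [] = mat 1" "op_prod (A # As) = A ** op_prod As"
  by (simp_all add: op_prod_def)

lemma op_prod_append: "op_prod (As @ Bs) = op_prod As ** op_prod Bs"
  by (induction As) (simp_all add: matrix_mul_assoc)

lemma adj_op_prod: "adj (op_prod As) = op_prod (rev (map adj As))"
  by (induction As) (simp_all add: adj_mult op_prod_append)

lemma adj_exc: "adj (exc ps is) = exc is ps"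
proof -
  have "map adj (map cre xs) = map ann xs" "map adj (map ann xs) = map cre xs" for xs :: "'a list"
    by (simp_all add: cre_def)
  then show ?thesis
    by (simp add: exc_def adj_mult adj_op_prod rev_map[symmetric] del: map_map)
qed

lemma controls_axis:
  "op_prod (map num qs) *v axis S 1 = (if set qs \<subseteq> S then axis S 1 else 0)"
  by (induction qs) (auto simp: op_axis_simps num_axis)

lemma controls_commute_cre:
  assumes "p \<notin> set qs"
  shows "op_prod (map num qs) ** cre p = cre p ** op_prod (map num qs)"
proof (rule op_eqI)
  fix S
  have "set qs \<subseteq> insert p S \<longleftrightarrow> set qs \<subseteq> S" using assms by auto
  then show "(op_prod (map num qs) ** cre p) *v axis S 1
      = (cre p ** op_prod (map num qs)) *v axis S 1"
    by (simp add: op_axis_simps controls_axis)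
qed

lemma controls_commute_ann:
  assumes "p \<notin> set qs"
  shows "op_prod (map num qs) ** ann p = ann p ** op_prod (map num qs)"
proof (rule op_eqI)
  fix S
  have "set qs \<subseteq> S - {p} \<longleftrightarrow> set qs \<subseteq> S" using assms by auto
  then show "(op_prod (map num qs) ** ann p) *v axis S 1
      = (ann p ** op_prod (map num qs)) *v axis S 1"
    by (simp add: op_axis_simps controls_axis)
qed

lemma op_prod_commute:
  assumes "\<And>A. A \<in> set As \<Longrightarrow> N ** A = A ** N"
  shows "N ** op_prod As = op_prod As ** N"
  using assms
proof (induction As)
  case (Cons A As)
  have "N ** (A ** op_prod As) = A ** (N ** op_prod As)"
    using Cons.prems by (simp add: matrix_mul_assoc)
  also have "\<dots> = A ** (op_prod As ** N)" using Cons by simp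
  finally show ?case by (simp add: matrix_mul_assoc)
qed simp

lemma controls_commute_exc:
  assumes "set qs \<inter> (set ps \<union> set is) = {}"
  shows "op_prod (map num qs) ** exc ps is = exc ps is ** op_prod (map num qs)"
proof -
  let ?N = "op_prod (map num qs)"
  have "?N ** op_prod (map cre ps @ map ann (rev is)) = op_prod (map cre ps @ map ann (rev is)) ** ?N"
    using assms by (intro op_prod_commute) (auto intro!: controls_commute_cre controls_commute_ann)
  then show ?thesis by (simp add: exc_def op_prod_append)
qed

lemma slater_axis: "\<exists>c. slater rs = c *s axis (set rs) 1"
proof (induction rs)
  case Nil
  show ?case by (rule exI[of _ 1]) (simp add: slater_def vac_def vec_eq_iff)
next
  case (Cons r rs)
  then obtain c where c: "slater rs = c *s axis (set rs) 1" by blast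
  have "slater (r # rs) = cre r *v slater rs"
    by (simp add: slater_def matrix_vector_mul_assoc)
  also have "\<dots> = (if r \<in> set rs then 0 else c * fsign r (set rs)) *s axis (set (r # rs)) 1"
    by (simp add: c op_axis_simps vector_smult_assoc)
  finally show ?case by blast
qed

lemma controls_slater:
  "op_prod (map num qs) *v slater rs = (if set qs \<subseteq> set rs then slater rs else 0)"
proof -
  obtain c where "slater rs = c *s axis (set rs) 1" using slater_axis by blast
  then show ?thesis by (simp add: op_axis_simps controls_axis)
qed

text \<open>The controlled factor acts as the uncontrolled one if all controls are occupied, and as the
  identity otherwise.\<close>

lemma cucc_slater:
  assumes "set qs \<inter> (set ps \<union> set is) = {}"
  shows "cucc qs ps is \<theta> *v slater rs
      = (if set qs \<subseteq> set rs then ucc ps is \<theta> *v slater rs else slater rs)"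
proof -
  define N where "N = op_prod (map num qs)"
  define K where "K = \<theta> *\<^sub>R (exc ps is - adj (exc ps is))"
  have K': "\<theta> *\<^sub>R (N ** (exc ps is - adj (exc ps is))) = N ** K"
    by (simp add: K_def bounded_bilinear.scaleR_right[OF bounded_bilinear_op_mult])
  have comm: "N ** K = K ** N"
    using controls_commute_exc[OF assms] controls_commute_exc[of qs "is" ps] assms
    by (simp add: N_def K_def adj_exc Un_commute
        bounded_bilinear.scaleR_right[OF bounded_bilinear_op_mult]
        bounded_bilinear.scaleR_left[OF bounded_bilinear_op_mult]
        bounded_bilinear.diff_right[OF bounded_bilinear_op_mult]
        bounded_bilinear.diff_left[OF bounded_bilinear_op_mult])
  show ?thesis
  proof (cases "set qs \<subseteq> set rs")
    case True
    then have N: "N *v slater rs = slater rs" by (simp add: N_def controls_slater)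
    have NK: "N *v (op_pow K k *v slater rs) = op_pow K k *v slater rs" for k
    proof (induction k)
      case (Suc k)
      have "N *v (op_pow K (Suc k) *v slater rs) = (N ** K) *v (op_pow K k *v slater rs)"
        by (simp add: matrix_vector_mul_assoc matrix_mul_assoc)
      also have "\<dots> = K *v (N *v (op_pow K k *v slater rs))"
        by (simp only: comm matrix_vector_mul_assoc matrix_mul_assoc)
      also have "\<dots> = op_pow K (Suc k) *v slater rs"
        by (simp only: Suc op_pow.simps) (simp add: matrix_vector_mul_assoc)
      finally show ?case .
    qed (simp add: N)
    have "op_pow (N ** K) k *v slater rs = op_pow K k *v slater rs" for k
    proof (induction k)
      case (Suc k)
      have "op_pow (N ** K) (Suc k) *v slater rs = N *v (K *v (op_pow (N ** K) k *v slater rs))"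
        by (simp add: matrix_vector_mul_assoc matrix_mul_assoc)
      also have "\<dots> = N *v (op_pow K (Suc k) *v slater rs)"
        unfolding Suc by (simp add: matrix_vector_mul_assoc matrix_mul_assoc)
      finally show ?case by (simp only: NK)
    qed simp
    then have "op_exp (N ** K) *v slater rs = op_exp K *v slater rs"
      using op_exp_sums[of "N ** K" "slater rs"] op_exp_sums[of K "slater rs"]
      by (simp add: sums_iff)
    with True show ?thesis unfolding cucc_def ucc_def N_def[symmetric] K' by (simp add: K_def)
  next
    case False
    then have "N *v slater rs = 0" by (simp add: N_def controls_slater)
    then have "(N ** K) *v slater rs = 0"
      by (simp add: comm matrix_vector_mul_assoc[symmetric])
    then have "op_pow (N ** K) (Suc k) *v slater rs = 0" for k
    proof (induction k)
      case (Suc k)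
      then show ?case
        by (simp only: op_pow.simps(2)[of _ "Suc k"] matrix_vector_mul_assoc[symmetric])
           (simp add: matrix_vector_mult_0_right)
    qed simp
    then have "op_pow (N ** K) k *v slater rs = 0" if "k \<notin> {0}" for k
      using that by (cases k) auto
    then have "(\<lambda>k. (1 / fact k) *\<^sub>R (op_pow (N ** K) k *v slater rs)) sums
        (\<Sum>k\<in>{0}. (1 / fact k) *\<^sub>R (op_pow (N ** K) k *v slater rs))"
      by (intro sums_finite) auto
    then have "(\<lambda>k. (1 / fact k) *\<^sub>R (op_pow (N ** K) k *v slater rs)) sums slater rs"
      by simp
    then have "op_exp (N ** K) *v slater rs = slater rs"
      using op_exp_sums[of "N ** K" "slater rs"] sums_unique2 by blast
    with False show ?thesis unfolding cucc_def N_def[symmetric] K' by simp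
  qed
qed

end

theory Submission
  imports Defs
begin

text \<open>
  An anti-Hermitian generator \<open>K\<close> that maps \<open>\<psi>\<close> to \<open>\<psi>'\<close> and \<open>\<psi>'\<close> to \<open>- \<psi>\<close> rotates their span, so a
  factor with angle \<open>\<pi>/2\<close> is a signed exchange.  The two inner triples move \<open>abc\<close> to \<open>uv\<eta>\<^sub>1\<close> and
  \<open>def\<close> to \<open>xy\<eta>\<^sub>2\<close>.  Only the first determinant then becomes \<open>uv\<eta>\<^sub>1xy\<eta>\<^sub>2\<close>, and the controls let the
  double rotate it with \<open>uvwxyz\<close> alone; the triples cannot touch the latter since its ancillas are
  empty.  The two outer triples undo the relabelling.
\<close>

section \<open>Exponentials acting as a rotation or trivially\<close>

lemma scaleR_eq_smult: "r *\<^sub>R \<psi> = complex_of_real r *s \<psi>" for \<psi> :: "'o::finite fock"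
  by (simp add: vec_eq_iff scaleR_conv_of_real[where 'a = complex])

lemma op_scaleR_mult_vec: "(r *\<^sub>R A) *v \<psi> = r *\<^sub>R (A *v \<psi>)" for A :: "'o::finite fop"
  unfolding vec_eq_iff by (simp add: matrix_vector_mult_def scaleR_sum_right)

lemma op_mult_scaleR_vec: "A *v (r *\<^sub>R \<psi>) = r *\<^sub>R (A *v \<psi>)" for A :: "'o::finite fop"
  unfolding scaleR_eq_smult by (rule mult_smult_vec)

text \<open>Since \<open>K ** K\<close> acts as -1 on \<psi> and \<psi>', the even terms of the
  series are multiples of \<psi> and the odd ones multiples of \<psi>'. They sum to the cosine and
  the sine.\<close>

lemma op_exp_rotation:
  fixes K :: "'o::finite fop"
  assumes "K *v \<psi> = \<psi>'" and "K *v \<psi>' = - \<psi>"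
  shows "op_exp (\<theta> *\<^sub>R K) *v \<psi> = complex_of_real (cos \<theta>) *s \<psi> + complex_of_real (sin \<theta>) *s \<psi>'"
proof -
  have series: "(1 / fact k) *\<^sub>R (op_pow (\<theta> *\<^sub>R K) k *v \<psi>)
      = (cos_coeff k *\<^sub>R \<theta> ^ k) *\<^sub>R \<psi> + (sin_coeff k *\<^sub>R \<theta> ^ k) *\<^sub>R \<psi>'" for k
  proof (induction k)
    case 0
    show ?case by simp
  next
    case (Suc k)
    have "(1 / fact (Suc k)) *\<^sub>R (op_pow (\<theta> *\<^sub>R K) (Suc k) *v \<psi>)
        = (\<theta> / real (Suc k)) *\<^sub>R (K *v ((1 / fact k) *\<^sub>R (op_pow (\<theta> *\<^sub>R K) k *v \<psi>)))"
      by (simp add: matrix_vector_mul_assoc[symmetric] op_scaleR_mult_vec op_mult_scaleR_vec)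
    also have "\<dots> = (\<theta> / real (Suc k)) *\<^sub>R
        ((cos_coeff k *\<^sub>R \<theta> ^ k) *\<^sub>R \<psi>' - (sin_coeff k *\<^sub>R \<theta> ^ k) *\<^sub>R \<psi>)"
      unfolding Suc by (simp add: matrix_vector_right_distrib op_mult_scaleR_vec assms)
    \<comment> \<open>The minus sign from \<open>K *v \<psi>' = - \<psi>\<close> matches the one in
      the recurrence \<open>cos_coeff (Suc k) = - sin_coeff k / real (Suc k)\<close>.\<close>
    also have "\<dots> = (cos_coeff (Suc k) *\<^sub>R \<theta> ^ Suc k) *\<^sub>R \<psi> + (sin_coeff (Suc k) *\<^sub>R \<theta> ^ Suc k) *\<^sub>R \<psi>'"
      by (simp add: cos_coeff_Suc sin_coeff_Suc scaleR_right_diff_distrib mult_ac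
          del: of_nat_Suc)
    finally show ?case .
  qed
  have "(\<lambda>k. (cos_coeff k *\<^sub>R \<theta> ^ k) *\<^sub>R \<psi> + (sin_coeff k *\<^sub>R \<theta> ^ k) *\<^sub>R \<psi>')
      sums (cos \<theta> *\<^sub>R \<psi> + sin \<theta> *\<^sub>R \<psi>')"
    by (intro sums_add sums_scaleR_left cos_converges sin_converges)
  then have "op_exp (\<theta> *\<^sub>R K) *v \<psi> = cos \<theta> *\<^sub>R \<psi> + sin \<theta> *\<^sub>R \<psi>'"
    using op_exp_sums[of "\<theta> *\<^sub>R K" \<psi>] unfolding series by (rule sums_unique2[symmetric])
  then show ?thesis by (simp only: scaleR_eq_smult)
qed

lemma op_exp_fixes:
  fixes K :: "'o::finite fop"
  assumes "K *v \<psi> = 0"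
  shows "op_exp (\<theta> *\<^sub>R K) *v \<psi> = \<psi>"
proof -
  have "op_pow (\<theta> *\<^sub>R K) (Suc k) *v \<psi> = 0" for k
  proof (induction k)
    case 0
    show ?case by (simp add: op_scaleR_mult_vec assms)
  next
    case (Suc k)
    then show ?case
      by (simp only: op_pow.simps(2)[of _ "Suc k"] matrix_vector_mul_assoc[symmetric]
          matrix_vector_mult_0_right)
  qed
  then have "(1 / fact k) *\<^sub>R (op_pow (\<theta> *\<^sub>R K) k *v \<psi>) = (if k = 0 then \<psi> else 0)" for k
    by (cases k) (simp_all del: op_pow.simps(2))
  then have "(\<lambda>k. if k = 0 then \<psi> else 0) sums (op_exp (\<theta> *\<^sub>R K) *v \<psi>)"
    using op_exp_sums[of "\<theta> *\<^sub>R K" \<psi>] by simp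
  then show ?thesis
    using sums_single[of 0 "\<lambda>_. \<psi>"] sums_unique2 by fastforce
qed

section \<open>Strings of ladder operators on determinants\<close>

lemma slater_Cons: "slater (r # rs) = cre r *v slater rs"
  by (simp add: slater_def matrix_vector_mul_assoc)

lemma slater_append: "slater (ps @ rs) = op_prod (map cre ps) *v slater rs"
  by (simp add: slater_def op_prod_append matrix_vector_mul_assoc)

lemma ann_slater_notin:
  assumes "p \<notin> set rs"
  shows "ann p *v slater rs = 0"
proof -
  obtain c where "slater rs = c *s axis (set rs) 1" using slater_axis by blast
  then show ?thesis using assms by (simp add: mult_smult_vec ann_axis)
qed

text \<open>The second term of the anticommutator \<open>ann_cre\<close> at equal orbitals kills
  \<open>slater rs\<close>, where \<open>p\<close> is empty. So no sign from the auxiliary orbital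
  order enters.\<close>

lemma ann_slater_Cons:
  assumes "p \<notin> set rs"
  shows "ann p *v slater (p # rs) = slater rs"
proof -
  have "ann p *v slater (p # rs) + cre p *v (ann p *v slater rs) = slater rs"
    using arg_cong[OF ann_cre[of p p], of "\<lambda>A. A *v slater rs"]
    by (simp add: slater_Cons matrix_vector_mult_add_rdistrib matrix_vector_mul_assoc)
  then show ?thesis by (simp add: ann_slater_notin[OF assms])
qed

text \<open>Because of \<open>rev\<close>, the annihilator of the first listed orbital acts first.
  Each annihilator finds its orbital in front and no sign arises.\<close>

lemma anns_slater:
  assumes "distinct (is @ rs)"
  shows "op_prod (map ann (rev is)) *v slater (is @ rs) = slater rs"
  using assms
  by (induction "is")
     (simp_all add: op_prod_append matrix_vector_mul_assoc[symmetric] ann_slater_Cons)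

text \<open>The set \<open>S\<close> shrinks in the induction: if the first orbital is occupied it
  is removed, and a missing one remains among the rest.\<close>

lemma anns_axis_eq_0:
  assumes "\<not> set is \<subseteq> S"
  shows "op_prod (map ann (rev is)) *v axis S 1 = 0"
  using assms
proof (induction "is" arbitrary: S)
  case (Cons i "is")
  show ?case
  proof (cases "i \<in> S")
    case True
    with Cons.prems have "\<not> set is \<subseteq> S - {i}" by auto
    from Cons.IH[OF this] True show ?thesis
      by (simp add: op_prod_append matrix_vector_mul_assoc[symmetric] ann_axis mult_smult_vec)
  next
    case False
    then show ?thesis
      by (simp add: op_prod_append matrix_vector_mul_assoc[symmetric] ann_axis)
  qed
qed simp

lemma exc_slater:
  assumes "distinct (is @ rs)"
  shows "exc ps is *v slater (is @ rs) = slater (ps @ rs)"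
  by (simp add: exc_def matrix_vector_mul_assoc[symmetric] anns_slater[OF assms] slater_append[of ps])

lemma exc_slater_eq_0:
  assumes "\<not> set is \<subseteq> set rs"
  shows "exc ps is *v slater rs = 0"
proof -
  obtain c where "slater rs = c *s axis (set rs) 1" using slater_axis by blast
  then show ?thesis
    by (simp add: exc_def matrix_vector_mul_assoc[symmetric] mult_smult_vec anns_axis_eq_0[OF assms])
qed

section \<open>Signs from reordering determinants\<close>

lemma slater_swap: "slater (p # q # rs) = - slater (q # p # rs)"
  using arg_cong[OF cre_cre[of p q], of "\<lambda>A. A *v slater rs"]
  by (simp add: slater_Cons matrix_vector_mult_add_rdistrib matrix_vector_mul_assoc
      eq_neg_iff_add_eq_0)

lemma mult_minus_vec: "A *v (- \<psi>) = - (A *v \<psi>)" for A :: "'o::finite fop"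
  using mult_smult_vec[of A "- 1" \<psi>] by simp

lemma slater_move_front: "slater (us @ p # rs) = (- 1) ^ length us *s slater (p # us @ rs)"
proof (induction us)
  case (Cons u us)
  then show ?case
    by (simp add: slater_Cons[of u] mult_smult_vec)
       (simp add: slater_Cons[symmetric] slater_swap[of u] vec_eq_iff)
qed simp

text \<open>The orbitals of \<open>ps\<close> move one by one past all of \<open>us\<close>, each
  crossing costing a factor -1.\<close>

lemma slater_block_swap:
  "slater (us @ ps @ rs) = (- 1) ^ (length us * length ps) *s slater (ps @ us @ rs)"
proof (induction ps arbitrary: us)
  case (Cons p ps)
  have "slater (us @ (p # ps) @ rs) = (- 1) ^ length us *s (cre p *v slater (us @ ps @ rs))"
    by (simp add: slater_move_front slater_Cons[symmetric])
  also have "\<dots> = (- 1) ^ length us * (- 1) ^ (length us * length ps) *s slater (p # ps @ us @ rs)"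
    unfolding Cons.IH[of us] by (simp add: mult_smult_vec slater_Cons vector_smult_assoc)
  finally show ?case by (simp add: power_add)
qed simp

section \<open>UCC factors on determinants\<close>

lemma ucc_slater_fixes:
  assumes "\<not> set is \<subseteq> set rs" and "\<not> set ps \<subseteq> set rs"
  shows "ucc ps is \<theta> *v slater rs = slater rs"
  unfolding ucc_def adj_exc
  by (intro op_exp_fixes) (simp add: matrix_vector_mult_diff_rdistrib exc_slater_eq_0 assms)

text \<open>The two blocks have equal length, so moving either one across \<open>us\<close> to the
  front costs the same sign, and these signs cancel. The generator then satisfies the hypotheses of
  \<open>op_exp_rotation\<close>.\<close>

lemma ucc_slater:
  assumes "distinct (us @ is @ rs)" and "distinct (us @ ps @ rs)"
    and "set is \<inter> set ps = {}" and "length is = length ps" and "ps \<noteq> []"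
  shows "ucc ps is \<theta> *v slater (us @ is @ rs)
      = complex_of_real (cos \<theta>) *s slater (us @ is @ rs)
        + complex_of_real (sin \<theta>) *s slater (us @ ps @ rs)" (is ?lower)
    and "ucc ps is \<theta> *v slater (us @ ps @ rs)
      = complex_of_real (cos \<theta>) *s slater (us @ ps @ rs)
        - complex_of_real (sin \<theta>) *s slater (us @ is @ rs)" (is ?upper)
proof -
  let ?K = "exc ps is - adj (exc ps is)"
  \<comment> \<open>Each block is nonempty and disjoint from the rest, so it has an orbital missing
    from the other determinant. Hence only one of the two terms of the generator acts on each
    determinant.\<close>
  have "is \<noteq> []" using assms(4,5) by auto
  then have "\<not> set is \<subseteq> set (us @ ps @ rs)" "\<not> set ps \<subseteq> set (us @ is @ rs)"
    using assms(1,2,3,5) by (cases "is"; cases ps; auto)+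
  then have zero: "exc ps is *v slater (us @ ps @ rs) = 0" "exc is ps *v slater (us @ is @ rs) = 0"
    using exc_slater_eq_0 by blast+
  have front: "distinct (is @ us @ rs)" "distinct (ps @ us @ rs)" using assms(1,2) by auto
  have "exc ps is *v slater (us @ is @ rs) = slater (us @ ps @ rs)"
    "exc is ps *v slater (us @ ps @ rs) = slater (us @ is @ rs)"
    unfolding slater_block_swap[of us "is"] slater_block_swap[of us ps]
    by (simp_all only: mult_smult_vec exc_slater front assms(4))
  with zero have K: "?K *v slater (us @ is @ rs) = slater (us @ ps @ rs)"
      "?K *v slater (us @ ps @ rs) = - slater (us @ is @ rs)"
    by (simp_all add: adj_exc matrix_vector_mult_diff_rdistrib)
  then show ?lower unfolding ucc_def by (rule op_exp_rotation)
  \<comment> \<open>The second rotation starts at the upper determinant, with the negated lower one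
    in the role of \<psi>'.\<close>
  have "?K *v (- slater (us @ is @ rs)) = - slater (us @ ps @ rs)"
    by (simp add: K mult_minus_vec)
  from op_exp_rotation[OF K(2) this] show ?upper
    unfolding ucc_def by (simp add: vec_eq_iff)
qed

text \<open>In total \<open>r\<close> passes two orbitals and \<open>o'\<close> passes four, so the
  signs cancel. This makes \<open>w, z\<close> and \<open>\<eta>\<^sub>1, \<eta>\<^sub>2\<close>,
  the pairs exchanged by the controlled double, leading blocks.\<close>

lemma slater_move_3_6: "slater [p, q, r, s, t, o'] = slater [r, o', p, q, s, t]"
  using slater_move_front[of "[p, q]" r "[s, t, o']"]
    slater_move_front[of "[r, p, q, s, t]" o' "[]"] slater_swap[of o' r "[p, q, s, t]"]
  by simp

theorem mainTheorem5:
  fixes a b c d e f u v w x y z \<eta>\<^sub>1 \<eta>\<^sub>2 \<phi>\<^sub>1 \<phi>\<^sub>2 \<phi>\<^sub>3 \<phi>\<^sub>4 \<phi>\<^sub>5 \<phi>\<^sub>6 :: "'o::finite"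
    and \<theta> :: real
    and \<xi>\<^sub>1 \<xi>\<^sub>2 \<xi>\<^sub>3 \<xi>\<^sub>4 :: complex
    and \<Psi> :: "'o fock"
  assumes "distinct [a, b, c, d, e, f, u, v, w, x, y, z, \<eta>\<^sub>1, \<eta>\<^sub>2]"
    and "{\<phi>\<^sub>1, \<phi>\<^sub>2, \<phi>\<^sub>3, \<phi>\<^sub>4, \<phi>\<^sub>5, \<phi>\<^sub>6} \<inter> {a, b, c, d, e, f, u, v, w, x, y, z, \<eta>\<^sub>1, \<eta>\<^sub>2} = {}"
    and "distinct [\<phi>\<^sub>1, \<phi>\<^sub>2, \<phi>\<^sub>3]"
    and "distinct [\<phi>\<^sub>4, \<phi>\<^sub>5, \<phi>\<^sub>6]"
    and "\<Psi> = \<xi>\<^sub>1 *s slater [a, b, c, d, e, f] + \<xi>\<^sub>2 *s slater [a, b, c, \<phi>\<^sub>1, \<phi>\<^sub>2, \<phi>\<^sub>3]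
            + \<xi>\<^sub>3 *s slater [d, e, f, \<phi>\<^sub>4, \<phi>\<^sub>5, \<phi>\<^sub>6] + \<xi>\<^sub>4 *s slater [u, v, w, x, y, z]"
  shows "(ucc [a, b, c] [u, v, \<eta>\<^sub>1] (pi / 2) ** ucc [d, e, f] [x, y, \<eta>\<^sub>2] (pi / 2)
            ** cucc [u, v, x, y] [w, z] [\<eta>\<^sub>1, \<eta>\<^sub>2] \<theta>
            ** ucc [x, y, \<eta>\<^sub>2] [d, e, f] (pi / 2) ** ucc [u, v, \<eta>\<^sub>1] [a, b, c] (pi / 2)) *v \<Psi>
         = op_exp (\<theta> *\<^sub>R (exc [u, v, w, x, y, z] [a, b, c, d, e, f]
                         - adj (exc [u, v, w, x, y, z] [a, b, c, d, e, f]))) *v \<Psi>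
       \<and> op_exp (\<theta> *\<^sub>R (exc [u, v, w, x, y, z] [a, b, c, d, e, f]
                         - adj (exc [u, v, w, x, y, z] [a, b, c, d, e, f]))) *v \<Psi>
         = \<xi>\<^sub>1 *s (complex_of_real (cos \<theta>) *s slater [a, b, c, d, e, f]
                   + complex_of_real (sin \<theta>) *s slater [u, v, w, x, y, z])
           + \<xi>\<^sub>2 *s slater [a, b, c, \<phi>\<^sub>1, \<phi>\<^sub>2, \<phi>\<^sub>3]
           + \<xi>\<^sub>3 *s slater [d, e, f, \<phi>\<^sub>4, \<phi>\<^sub>5, \<phi>\<^sub>6]
           + \<xi>\<^sub>4 *s (complex_of_real (cos \<theta>) *s slater [u, v, w, x, y, z]
                   - complex_of_real (sin \<theta>) *s slater [a, b, c, d, e, f])"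
proof -
  note dist = assms(1) and disj = assms(2) and \<Psi> = assms(5)
  define V1 where "V1 = ucc [u, v, \<eta>\<^sub>1] [a, b, c] (pi / 2)"
  define V2 where "V2 = ucc [x, y, \<eta>\<^sub>2] [d, e, f] (pi / 2)"
  define C where "C = cucc [u, v, x, y] [w, z] [\<eta>\<^sub>1, \<eta>\<^sub>2] \<theta>"
  define W2 where "W2 = ucc [d, e, f] [x, y, \<eta>\<^sub>2] (pi / 2)"
  define W1 where "W1 = ucc [a, b, c] [u, v, \<eta>\<^sub>1] (pi / 2)"
  define S where "S = ucc [u, v, w, x, y, z] [a, b, c, d, e, f] \<theta>"
  \<comment> \<open>At angle \<open>pi / 2\<close> the cosine is 0 and the sine is 1, so the block
    is replaced with coefficient +1.\<close>
  have V1: "V1 *v slater [a, b, c, d, e, f] = slater [u, v, \<eta>\<^sub>1, d, e, f]"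
    "V1 *v slater [a, b, c, \<phi>\<^sub>1, \<phi>\<^sub>2, \<phi>\<^sub>3] = slater [u, v, \<eta>\<^sub>1, \<phi>\<^sub>1, \<phi>\<^sub>2, \<phi>\<^sub>3]"
    using ucc_slater(1)[of "[]" "[a, b, c]" "[d, e, f]" "[u, v, \<eta>\<^sub>1]" "pi / 2"]
      ucc_slater(1)[of "[]" "[a, b, c]" "[\<phi>\<^sub>1, \<phi>\<^sub>2, \<phi>\<^sub>3]" "[u, v, \<eta>\<^sub>1]" "pi / 2"] assms(1-4)
    by (auto simp: V1_def)
  \<comment> \<open>In \<open>[u, v, w, x, y, z]\<close> the upper triple is incomplete only because
    the ancilla \<open>\<eta>\<^sub>1\<close> is empty.\<close>
  have V1': "V1 *v slater [d, e, f, \<phi>\<^sub>4, \<phi>\<^sub>5, \<phi>\<^sub>6] = slater [d, e, f, \<phi>\<^sub>4, \<phi>\<^sub>5, \<phi>\<^sub>6]"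
    "V1 *v slater [u, v, w, x, y, z] = slater [u, v, w, x, y, z]"
    unfolding V1_def by (rule ucc_slater_fixes; use dist disj in force)+
  \<comment> \<open>In the first determinant the block \<open>d, e, f\<close> stands behind
    \<open>u, v, \<eta>\<^sub>1\<close>, which is the prefix \<open>us\<close> of
    \<open>ucc_slater\<close>.\<close>
  have V2: "V2 *v slater [u, v, \<eta>\<^sub>1, d, e, f] = slater [u, v, \<eta>\<^sub>1, x, y, \<eta>\<^sub>2]"
    "V2 *v slater [d, e, f, \<phi>\<^sub>4, \<phi>\<^sub>5, \<phi>\<^sub>6] = slater [x, y, \<eta>\<^sub>2, \<phi>\<^sub>4, \<phi>\<^sub>5, \<phi>\<^sub>6]"
    using ucc_slater(1)[of "[u, v, \<eta>\<^sub>1]" "[d, e, f]" "[]" "[x, y, \<eta>\<^sub>2]" "pi / 2"]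
      ucc_slater(1)[of "[]" "[d, e, f]" "[\<phi>\<^sub>4, \<phi>\<^sub>5, \<phi>\<^sub>6]" "[x, y, \<eta>\<^sub>2]" "pi / 2"] assms(1-4)
    by (auto simp: V2_def)
  have V2': "V2 *v slater [u, v, \<eta>\<^sub>1, \<phi>\<^sub>1, \<phi>\<^sub>2, \<phi>\<^sub>3] = slater [u, v, \<eta>\<^sub>1, \<phi>\<^sub>1, \<phi>\<^sub>2, \<phi>\<^sub>3]"
    "V2 *v slater [u, v, w, x, y, z] = slater [u, v, w, x, y, z]"
    unfolding V2_def by (rule ucc_slater_fixes; use dist disj in force)+
  have ctrl: "set [u, v, x, y] \<inter> (set [w, z] \<union> set [\<eta>\<^sub>1, \<eta>\<^sub>2]) = {}"
    using dist by auto
  \<comment> \<open>All four controls are occupied in both determinants, so the controlled double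
    acts as the plain one.\<close>
  have C: "C *v slater [u, v, \<eta>\<^sub>1, x, y, \<eta>\<^sub>2]
      = complex_of_real (cos \<theta>) *s slater [u, v, \<eta>\<^sub>1, x, y, \<eta>\<^sub>2]
        + complex_of_real (sin \<theta>) *s slater [u, v, w, x, y, z]"
    "C *v slater [u, v, w, x, y, z]
      = complex_of_real (cos \<theta>) *s slater [u, v, w, x, y, z]
        - complex_of_real (sin \<theta>) *s slater [u, v, \<eta>\<^sub>1, x, y, \<eta>\<^sub>2]"
    using ucc_slater[of "[]" "[\<eta>\<^sub>1, \<eta>\<^sub>2]" "[u, v, x, y]" "[w, z]" \<theta>] dist
    by (auto simp: C_def cucc_slater[OF ctrl] slater_move_3_6[of u v _ x y])
  \<comment> \<open>The controls \<open>x, y\<close> are empty in the first determinant and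
    \<open>u, v\<close> in the second.\<close>
  have C': "C *v slater [u, v, \<eta>\<^sub>1, \<phi>\<^sub>1, \<phi>\<^sub>2, \<phi>\<^sub>3] = slater [u, v, \<eta>\<^sub>1, \<phi>\<^sub>1, \<phi>\<^sub>2, \<phi>\<^sub>3]"
    "C *v slater [x, y, \<eta>\<^sub>2, \<phi>\<^sub>4, \<phi>\<^sub>5, \<phi>\<^sub>6] = slater [x, y, \<eta>\<^sub>2, \<phi>\<^sub>4, \<phi>\<^sub>5, \<phi>\<^sub>6]"
    using dist disj by (auto simp: C_def cucc_slater[OF ctrl])
  \<comment> \<open>The outer triples have their upper and lower lists exchanged, so the way back is
    again a rotation from lower to upper and carries no minus sign.\<close>
  have W2: "W2 *v slater [u, v, \<eta>\<^sub>1, x, y, \<eta>\<^sub>2] = slater [u, v, \<eta>\<^sub>1, d, e, f]"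
    "W2 *v slater [x, y, \<eta>\<^sub>2, \<phi>\<^sub>4, \<phi>\<^sub>5, \<phi>\<^sub>6] = slater [d, e, f, \<phi>\<^sub>4, \<phi>\<^sub>5, \<phi>\<^sub>6]"
    using ucc_slater(1)[of "[u, v, \<eta>\<^sub>1]" "[x, y, \<eta>\<^sub>2]" "[]" "[d, e, f]" "pi / 2"]
      ucc_slater(1)[of "[]" "[x, y, \<eta>\<^sub>2]" "[\<phi>\<^sub>4, \<phi>\<^sub>5, \<phi>\<^sub>6]" "[d, e, f]" "pi / 2"] assms(1-4)
    by (auto simp: W2_def)
  have W2': "W2 *v slater [u, v, \<eta>\<^sub>1, \<phi>\<^sub>1, \<phi>\<^sub>2, \<phi>\<^sub>3] = slater [u, v, \<eta>\<^sub>1, \<phi>\<^sub>1, \<phi>\<^sub>2, \<phi>\<^sub>3]"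
    "W2 *v slater [u, v, w, x, y, z] = slater [u, v, w, x, y, z]"
    unfolding W2_def by (rule ucc_slater_fixes; use dist disj in force)+
  have W1: "W1 *v slater [u, v, \<eta>\<^sub>1, d, e, f] = slater [a, b, c, d, e, f]"
    "W1 *v slater [u, v, \<eta>\<^sub>1, \<phi>\<^sub>1, \<phi>\<^sub>2, \<phi>\<^sub>3] = slater [a, b, c, \<phi>\<^sub>1, \<phi>\<^sub>2, \<phi>\<^sub>3]"
    using ucc_slater(1)[of "[]" "[u, v, \<eta>\<^sub>1]" "[d, e, f]" "[a, b, c]" "pi / 2"]
      ucc_slater(1)[of "[]" "[u, v, \<eta>\<^sub>1]" "[\<phi>\<^sub>1, \<phi>\<^sub>2, \<phi>\<^sub>3]" "[a, b, c]" "pi / 2"] assms(1-4)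
    by (auto simp: W1_def)
  have W1': "W1 *v slater [d, e, f, \<phi>\<^sub>4, \<phi>\<^sub>5, \<phi>\<^sub>6] = slater [d, e, f, \<phi>\<^sub>4, \<phi>\<^sub>5, \<phi>\<^sub>6]"
    "W1 *v slater [u, v, w, x, y, z] = slater [u, v, w, x, y, z]"
    unfolding W1_def by (rule ucc_slater_fixes; use dist disj in force)+
  have S: "S *v slater [a, b, c, d, e, f]
      = complex_of_real (cos \<theta>) *s slater [a, b, c, d, e, f]
        + complex_of_real (sin \<theta>) *s slater [u, v, w, x, y, z]"
    "S *v slater [u, v, w, x, y, z]
      = complex_of_real (cos \<theta>) *s slater [u, v, w, x, y, z]
        - complex_of_real (sin \<theta>) *s slater [a, b, c, d, e, f]"
    using ucc_slater[of "[]" "[a, b, c, d, e, f]" "[]" "[u, v, w, x, y, z]" \<theta>] dist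
    by (auto simp: S_def)
  \<comment> \<open>Each determinant holds only three of \<open>a, b, c, d, e, f\<close> and none of
    \<open>u, v, w, x, y, z\<close>.\<close>
  have S': "S *v slater [a, b, c, \<phi>\<^sub>1, \<phi>\<^sub>2, \<phi>\<^sub>3] = slater [a, b, c, \<phi>\<^sub>1, \<phi>\<^sub>2, \<phi>\<^sub>3]"
    "S *v slater [d, e, f, \<phi>\<^sub>4, \<phi>\<^sub>5, \<phi>\<^sub>6] = slater [d, e, f, \<phi>\<^sub>4, \<phi>\<^sub>5, \<phi>\<^sub>6]"
    unfolding S_def by (rule ucc_slater_fixes; use dist disj in force)+
  \<comment> \<open>The double yields a combination of
    \<open>[u, v, \<eta>\<^sub>1, x, y, \<eta>\<^sub>2]\<close> and
    \<open>[u, v, w, x, y, z]\<close>. The outer triples fix the latter and turn the former into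
    \<open>[a, b, c, d, e, f]\<close>, which is the sextuple rotation term by term.\<close>
  have "(W1 ** W2 ** C ** V2 ** V1) *v \<Psi> = S *v \<Psi>"
    unfolding \<Psi> matrix_vector_mul_assoc[symmetric]
    by (simp only: matrix_vector_right_distrib matrix_vector_mult_diff_distrib mult_smult_vec
        V1 V1' V2 V2' C C' W2 W2' W1 W1' S S')
  moreover have "S *v \<Psi>
      = \<xi>\<^sub>1 *s (complex_of_real (cos \<theta>) *s slater [a, b, c, d, e, f]
             + complex_of_real (sin \<theta>) *s slater [u, v, w, x, y, z])
        + \<xi>\<^sub>2 *s slater [a, b, c, \<phi>\<^sub>1, \<phi>\<^sub>2, \<phi>\<^sub>3]
        + \<xi>\<^sub>3 *s slater [d, e, f, \<phi>\<^sub>4, \<phi>\<^sub>5, \<phi>\<^sub>6]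
        + \<xi>\<^sub>4 *s (complex_of_real (cos \<theta>) *s slater [u, v, w, x, y, z]
               - complex_of_real (sin \<theta>) *s slater [a, b, c, d, e, f])"
    unfolding \<Psi> by (simp only: matrix_vector_right_distrib mult_smult_vec S S')
  ultimately show ?thesis
    unfolding V1_def V2_def C_def W2_def W1_def S_def ucc_def by blast
qed

end
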